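(* The ordered field of oracles satisfies the axioms of the real numbers; that is, the set of all oracles, with the addition and multiplication induced from rational interval arithmetic and the order $<$ on oracles, is an ordered field in which every non-empty subset that is bounded above has a least upper bound.
   Context: For rationals $a,b$, $a:b$ denotes the set of rationals between $a$ and $b$ inclusive, regardless of order (so $a:b=b:a$; $a=b$ is allowed, and $a:a$ is called a singleton). These sets are called rational intervals. A rule is a function $R$ from rational intervals to $\{0,1\}$; an interval is $R$-Yes if $R(a:b)=1$ and $R$-No if $R(a:b)=0$. An oracle is a rule $R$ such that (all letters $a,b,c,d$ rational): (1) Consistency: if $c:d$ contains $a:b$ and $R(a:b)=1$, then $R(c:d)=1$. (2) Existence: $R(a:b)=1$ for some $a:b$. (3) Separating: if $R(a:b)=1$ and $c\in a:b$ with $c\neq a,b$, then $R(c:c)=1$ or $R(a:c)\neq R(c:b)$. (4) Rooted: there is at most one $c$ with $R(c:c)=1$. (5) Closed: if $c$ is contained in all $R$-Yes intervals, then $R(c:c)=1$. Two oracles are equal iff they agree on all rational intervals. Order: $R<S$ iff there are an $R$-Yes interval $a:b$ and an $S$-Yes interval $c:d$ such that both $a$ and $b$ are less than both $c$ and $d$. Interval arithmetic, for $a\le b$ and $c\le d$: $a:b\oplus c:d=(a+c):(b+d)$ and $a:b\otimes c:d=\min(ac,ad,bc,bd):\max(ac,ad,bc,bd)$. A fonsi is a set of pairwise intersecting rational intervals that contains, for every rational $q>0$, an interval of length less than $q$. For each fonsi there is a unique oracle for which all elements of the fonsi are Yes intervals (the associated oracle). For oracles $\alpha,\beta$, the families $\{A\oplus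 B\}$ and $\{A\otimes B\}$, with $A$ ranging over $\alpha$-Yes intervals and $B$ over $\beta$-Yes intervals, are fonsis; $\alpha+\beta$ and $\alpha*\beta$ are defined to be the respective associated oracles. *)

theory Defs
  imports Complex_Main "HOL-Library.Lub_Glb"
begin

typedef rat_interval = "{S :: rat set. \<exists>a b. S = {min a b..max a b}}"
  morphisms points Interval
  by blast

definition ivl :: "rat \<Rightarrow> rat \<Rightarrow> rat_interval"
  where "ivl a b = Interval {min a b..max a b}"

lemma points_ivl: "points (ivl a b) = {min a b..max a b}"
  unfolding ivl_def by (rule Interval_inverse) blast

(* R I is true iff I is R-Yes. *)
type_synonym rule = "rat_interval \<Rightarrow> bool"

definition consistency :: "rule \<Rightarrow> bool"
  where "consistency R \<longleftrightarrow>
    (\<forall>a b c d. points (ivl a b) \<subseteq> points (ivl c d) \<longrightarrow> R (ivl a b) \<longrightarrow> R (ivl c d))"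

definition existence :: "rule \<Rightarrow> bool"
  where "existence R \<longleftrightarrow> (\<exists>a b. R (ivl a b))"

definition separating :: "rule \<Rightarrow> bool"
  where "separating R \<longleftrightarrow>
    (\<forall>a b c. R (ivl a b) \<longrightarrow> c \<in> points (ivl a b) \<longrightarrow> c \<noteq> a \<longrightarrow> c \<noteq> b \<longrightarrow>
      R (ivl c c) \<or> R (ivl a c) \<noteq> R (ivl c b))"

definition rooted :: "rule \<Rightarrow> bool"
  where "rooted R \<longleftrightarrow> (\<forall>c d. R (ivl c c) \<longrightarrow> R (ivl d d) \<longrightarrow> c = d)"

definition closed_rule :: "rule \<Rightarrow> bool"
  where "closed_rule R \<longleftrightarrow>
    (\<forall>c. (\<forall>a b. R (ivl a b) \<longrightarrow> c \<in> points (ivl a b)) \<longrightarrow> R (ivl c c))"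

definition is_oracle :: "rule \<Rightarrow> bool"
  where "is_oracle R \<longleftrightarrow>
    consistency R \<and> existence R \<and> separating R \<and> rooted R \<and> closed_rule R"

typedef rat_oracle = "{R. is_oracle R}"
  morphisms yes Oracle
proof
  have c: "consistency (\<lambda>I. 0 \<in> points I)"
    unfolding consistency_def by blast
  have e: "existence (\<lambda>I. 0 \<in> points I)"
    unfolding existence_def by (rule exI[of _ 0], rule exI[of _ 0]) (simp add: points_ivl)
  have s: "separating (\<lambda>I. 0 \<in> points I)"
    unfolding separating_def by (auto simp: points_ivl min_def max_def split: if_splits)
  have r: "rooted (\<lambda>I. 0 \<in> points I)"
    unfolding rooted_def by (simp add: points_ivl)
  have l: "closed_rule (\<lambda>I. 0 \<in> points I)"
    unfolding closed_rule_def
  proof (intro allI impI)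
    fix c :: rat
    assume "\<forall>a b. 0 \<in> points (ivl a b) \<longrightarrow> c \<in> points (ivl a b)"
    then have "0 \<in> points (ivl 0 0) \<longrightarrow> c \<in> points (ivl 0 0)" by blast
    then show "0 \<in> points (ivl c c)" by (simp add: points_ivl)
  qed
  show "(\<lambda>I. 0 \<in> points I) \<in> {R. is_oracle R}"
    using c e s r l by (simp add: is_oracle_def)
qed

definition lo :: "rat_interval \<Rightarrow> rat"
  where "lo I = (LEAST x. x \<in> points I)"

definition hi :: "rat_interval \<Rightarrow> rat"
  where "hi I = (GREATEST x. x \<in> points I)"

lemma lo_ivl: "lo (ivl a b) = min a b"
  unfolding lo_def points_ivl by (rule Least_equality) auto

lemma hi_ivl: "hi (ivl a b) = max a b"
  unfolding hi_def points_ivl by (rule Greatest_equality) auto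

definition iadd :: "rat_interval \<Rightarrow> rat_interval \<Rightarrow> rat_interval"  (infixl "\<oplus>" 65)
  where "I \<oplus> J = ivl (lo I + lo J) (hi I + hi J)"

definition imult :: "rat_interval \<Rightarrow> rat_interval \<Rightarrow> rat_interval"  (infixl "\<otimes>" 70)
  where "I \<otimes> J =
    (let P = {lo I * lo J, lo I * hi J, hi I * lo J, hi I * hi J} in ivl (Min P) (Max P))"

lemma iadd_ivl: "a \<le> b \<Longrightarrow> c \<le> d \<Longrightarrow> ivl a b \<oplus> ivl c d = ivl (a + c) (b + d)"
  by (simp add: iadd_def lo_ivl hi_ivl)

lemma imult_ivl: "a \<le> b \<Longrightarrow> c \<le> d \<Longrightarrow>
    ivl a b \<otimes> ivl c d = ivl (Min {a*c, a*d, b*c, b*d}) (Max {a*c, a*d, b*c, b*d})"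
  by (simp add: imult_def lo_ivl hi_ivl Let_def)

definition fonsi :: "rat_interval set \<Rightarrow> bool"
  where "fonsi F \<longleftrightarrow>
    (\<forall>I\<in>F. \<forall>J\<in>F. points I \<inter> points J \<noteq> {}) \<and>
    (\<forall>q>0. \<exists>I\<in>F. hi I - lo I < q)"

(* Meaningful for a fonsi F, where such an \<alpha> exists and is unique;
   otherwise THE is unspecified. *)
definition associated_oracle :: "rat_interval set \<Rightarrow> rat_oracle"
  where "associated_oracle F = (THE \<alpha>. \<forall>I\<in>F. yes \<alpha> I)"

instantiation rat_oracle :: "{plus, times, ord}"
begin

definition plus_rat_oracle :: "rat_oracle \<Rightarrow> rat_oracle \<Rightarrow> rat_oracle"
  where "\<alpha> + \<beta> = associated_oracle {A \<oplus> B | A B. yes \<alpha> A \<and> yes \<beta> B}"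

definition times_rat_oracle :: "rat_oracle \<Rightarrow> rat_oracle \<Rightarrow> rat_oracle"
  where "\<alpha> * \<beta> = associated_oracle {A \<otimes> B | A B. yes \<alpha> A \<and> yes \<beta> B}"

definition less_rat_oracle :: "rat_oracle \<Rightarrow> rat_oracle \<Rightarrow> bool"
  where "\<alpha> < \<beta> \<longleftrightarrow>
    (\<exists>a b c d. yes \<alpha> (ivl a b) \<and> yes \<beta> (ivl c d) \<and> a < c \<and> a < d \<and> b < c \<and> b < d)"

definition less_eq_rat_oracle :: "rat_oracle \<Rightarrow> rat_oracle \<Rightarrow> bool"
  where "\<alpha> \<le> \<beta> \<longleftrightarrow> \<alpha> < \<beta> \<or> \<alpha> = (\<beta> :: rat_oracle)"

instance ..

end

end

(* Oracles are the rules I |-> (x lies between the endpoints of I) for real x. The Yes intervals of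
   an oracle pairwise intersect (otherwise every rational in the gap would be a root), and bisection
   by the separating property makes them arbitrarily short, so they pin down a real number x; closedness
   takes care of a rational x that is an endpoint. Under this bijection the order, sum and product
   of oracles become those of the reals, and the whole structure is transported from the reals. *)
theory Submission
  imports Defs
begin

section \<open>Rational intervals around a real number\<close>

lemma rat_interval_cases:
  obtains a b where "I = ivl a b" "a \<le> b"
proof -
  obtain a b where "points I = {min a b..max a b}"
    using points[of I] by blast
  then have "points I = points (ivl (min a b) (max a b))"
    by (simp add: points_ivl)
  then have "I = ivl (min a b) (max a b)"
    by (simp add: points_inject)
  then show thesis by (rule that) simp
qed

lemma ivl_commute: "ivl a b = ivl b a"
  unfolding ivl_def by (metis max.commute min.commute)

text \<open>Both comparisons are non-strict: for rational \<open>x\<close> the singleton at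
  \<open>x\<close> has to be Yes, as closedness demands.\<close>

definition encloses :: "real \<Rightarrow> rule"
  where "encloses x I \<longleftrightarrow> of_rat (lo I) \<le> x \<and> x \<le> of_rat (hi I)"

lemma encloses_ivl: "a \<le> b \<Longrightarrow> encloses x (ivl a b) \<longleftrightarrow> of_rat a \<le> x \<and> x \<le> of_rat b"
  by (simp add: encloses_def lo_ivl hi_ivl)

lemma encloses_ivl_min_max:
  "encloses x (ivl a b) \<longleftrightarrow> of_rat (min a b) \<le> x \<and> x \<le> of_rat (max a b)"
  by (simp add: encloses_def lo_ivl hi_ivl)

text \<open>Were \<open>x\<close> and \<open>y\<close> distinct, a rational strictly between them,
  paired with any rational on the far side of \<open>x\<close>, would bound an interval holding
  \<open>x\<close> but not \<open>y\<close>. This gives both the injectivity of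
  \<open>encloses\<close> and the closedness of \<open>encloses x\<close>.\<close>

lemma of_rat_between_eq:
  fixes x y :: real
  assumes "\<And>a b. of_rat a \<le> x \<Longrightarrow> x \<le> of_rat b \<Longrightarrow> of_rat a \<le> y \<and> y \<le> of_rat b"
  shows "x = y"
proof (rule ccontr)
  obtain a b where ab: "of_rat a < x" "x < of_rat b"
    by (meson of_rat_dense lt_ex gt_ex)
  assume "x \<noteq> y"
  then consider "x < y" | "y < x" by linarith
  then show False
  proof cases
    case 1
    then obtain q where "x < of_rat q" "of_rat q < y" using of_rat_dense by blast
    with assms[of a q] ab show False by linarith
  next
    case 2
    then obtain q where "y < of_rat q" "of_rat q < x" using of_rat_dense by blast
    with assms[of q b] ab show False by linarith
  qed
qed

lemma encloses_inject: "encloses x = encloses y \<longleftrightarrow> x = y"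
proof
  assume eq: "encloses x = encloses y"
  show "x = y"
  proof (rule of_rat_between_eq)
    fix a b assume ab: "of_rat a \<le> x" "x \<le> of_rat b"
    then have "a \<le> b" by (metis of_rat_less_eq order_trans)
    with ab eq encloses_ivl show "of_rat a \<le> y \<and> y \<le> of_rat b" by metis
  qed
qed simp

section \<open>The rule of a real number is an oracle\<close>

lemma is_oracle_encloses: "is_oracle (encloses x)"
  unfolding is_oracle_def
proof (intro conjI)
  show "consistency (encloses x)"
    unfolding consistency_def
  proof (intro allI impI)
    fix a b c d
    assume sub: "points (ivl a b) \<subseteq> points (ivl c d)" and e: "encloses x (ivl a b)"
    have "min c d \<le> min a b" "max a b \<le> max c d"
      using sub by (simp_all add: points_ivl)
    then have "of_rat (min c d) \<le> (of_rat (min a b) :: real)"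
      "of_rat (max a b) \<le> (of_rat (max c d) :: real)"
      by (simp_all only: of_rat_less_eq)
    with e show "encloses x (ivl c d)"
      unfolding encloses_ivl_min_max by linarith
  qed
  show "existence (encloses x)"
  proof -
    obtain a b where "of_rat a < x" "x < of_rat b"
      by (meson of_rat_dense lt_ex gt_ex)
    moreover from this have "a \<le> b"
      by (metis less_trans of_rat_less less_imp_le)
    ultimately show ?thesis
      unfolding existence_def using encloses_ivl by (meson less_imp_le)
  qed
  \<comment> \<open>For \<open>x = of_rat c\<close> the singleton is Yes; otherwise \<open>x\<close>
    lies strictly on one side of \<open>c\<close>, so exactly one of the two pieces holds
    it.\<close>
  show "separating (encloses x)"
    unfolding separating_def encloses_ivl_min_max points_ivl
    by (auto simp: min_def max_def of_rat_less_eq split: if_splits)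
  show "rooted (encloses x)"
    unfolding rooted_def encloses_ivl_min_max by (auto dest: order_antisym)
  show "closed_rule (encloses x)"
    unfolding closed_rule_def
  proof (intro allI impI)
    fix c assume all: "\<forall>a b. encloses x (ivl a b) \<longrightarrow> c \<in> points (ivl a b)"
    have "x = of_rat c"
    proof (rule of_rat_between_eq)
      fix a b assume ab: "of_rat a \<le> x" "x \<le> of_rat b"
      then have "a \<le> b" by (metis of_rat_less_eq order_trans)
      with ab all have "c \<in> points (ivl a b)" by (simp add: encloses_ivl)
      with \<open>a \<le> b\<close> show "of_rat a \<le> (of_rat c :: real) \<and> of_rat c \<le> (of_rat b :: real)"
        by (simp add: points_ivl of_rat_less_eq)
    qed
    then show "encloses x (ivl c c)" by (simp add: encloses_ivl)
  qed
qed

section \<open>Every oracle is the rule of a real number\<close>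

lemma is_oracle_mono:
  assumes "is_oracle R" "R (ivl a b)" "c \<le> a" "a \<le> b" "b \<le> d"
  shows "R (ivl c d)"
proof -
  have "points (ivl a b) \<subseteq> points (ivl c d)"
    using assms by (auto simp: points_ivl)
  then show ?thesis
    using assms(1,2) unfolding is_oracle_def consistency_def by blast
qed

text \<open>Used with the roles exchanged as well, this says that Yes intervals intersect. If
  \<open>d < a\<close>, then for each \<open>m\<close> in the gap the interval from \<open>c\<close>
  to \<open>b\<close> is Yes and so are both of its pieces at \<open>m\<close>, as they contain the
  given Yes intervals. Separating then makes \<open>m\<close> a root, and two such \<open>m\<close>
  contradict rootedness.\<close>

lemma is_oracle_yes_le:
  assumes R: "is_oracle R" and ab: "a \<le> b" "R (ivl a b)" and cd: "c \<le> d" "R (ivl c d)"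
  shows "a \<le> d"
proof (rule ccontr)
  assume "\<not> a \<le> d"
  then have "d < a" by simp
  have root: "R (ivl m m)" if "d < m" "m < a" for m
  proof -
    have "R (ivl c b)" "R (ivl c m)" "R (ivl m b)"
      using is_oracle_mono[OF R] that ab cd by (meson less_imp_le order_trans order_refl)+
    moreover have "m \<in> points (ivl c b)" "m \<noteq> c" "m \<noteq> b"
      using that ab cd by (auto simp: points_ivl)
    ultimately show ?thesis
      using R unfolding is_oracle_def separating_def by blast
  qed
  obtain m where m: "d < m" "m < a" using \<open>d < a\<close> dense by blast
  obtain n where n: "d < n" "n < m" using m dense by blast
  have "R (ivl m m)" "R (ivl n n)" using root m n by auto
  then show False
    using R n unfolding is_oracle_def rooted_def by blast
qed

lemma is_oracle_bisect:
  assumes R: "is_oracle R" and "a \<le> b" "R (ivl a b)"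
  shows "\<exists>c d. c \<le> d \<and> R (ivl c d) \<and> d - c \<le> (b - a) / 2 ^ n"
proof (induction n)
  case 0
  then show ?case using assms by auto
next
  case (Suc n)
  then obtain c d where cd: "c \<le> d" "R (ivl c d)" "d - c \<le> (b - a) / 2 ^ n" by blast
  show ?case
  proof (cases "c = d")
    case True
    \<comment> \<open>A singleton has no interior point to split at, but its length 0 already meets
      the halved bound.\<close>
    with cd assms show ?thesis by (intro exI[of _ c] exI[of _ d]) simp
  next
    case False
    define m where "m = (c + d) / 2"
    have m: "c < m" "m < d" "m - c = (d - c) / 2" "d - m = (d - c) / 2"
      using False cd(1) by (auto simp: m_def field_simps)
    then have "m \<in> points (ivl c d)" by (simp add: points_ivl)
    \<comment> \<open>Whichever of the three is Yes, it is at most half as long as the interval from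
      \<open>c\<close> to \<open>d\<close>.\<close>
    then have "R (ivl m m) \<or> R (ivl c m) \<or> R (ivl m d)"
      using R cd(2) m unfolding is_oracle_def separating_def by blast
    moreover have "0 \<le> (b - a) / 2 ^ Suc n"
      using assms by simp
    moreover have "(d - c) / 2 \<le> (b - a) / 2 ^ Suc n"
      using cd(3) by (simp add: field_simps)
    ultimately show ?thesis
      using m by (metis diff_self less_imp_le order_refl)
  qed
qed

lemma is_oracle_short:
  assumes R: "is_oracle R" and "e > 0"
  obtains a b where "a \<le> b" "R (ivl a b)" "b - a < e"
proof -
  obtain a b where ab: "a \<le> b" "R (ivl a b)"
    using R unfolding is_oracle_def existence_def by (metis ivl_commute linear)
  \<comment> \<open>As \<open>n < 2 ^ n\<close>, any \<open>n\<close> above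
    \<open>(b - a) / e\<close> is enough halvings.\<close>
  obtain n where "(b - a) / e < of_nat n" using reals_Archimedean2 by blast
  also have "of_nat n < (2 :: rat) ^ n" by (rule of_nat_less_two_power)
  finally have "(b - a) / 2 ^ n < e"
    using \<open>e > 0\<close> by (simp add: field_simps)
  with is_oracle_bisect[OF R ab, of n] that show thesis by fastforce
qed

lemma is_oracle_imp_encloses:
  assumes R: "is_oracle R"
  obtains x where "R = encloses x"
proof -
  define L where "L = {real_of_rat a | a b. a \<le> b \<and> R (ivl a b)}"
  obtain a0 b0 where ab0: "a0 \<le> b0" "R (ivl a0 b0)"
    using is_oracle_short[OF R zero_less_one] by blast
  \<comment> \<open>Left endpoints never exceed right endpoints, so the supremum of the left
    endpoints, chosen as \<open>x\<close> below, lies in every Yes interval.\<close>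
  have upper: "l \<le> of_rat d" if "l \<in> L" "c \<le> d" "R (ivl c d)" for l c d
  proof -
    obtain a b where "l = of_rat a" "a \<le> b" "R (ivl a b)"
      using \<open>l \<in> L\<close> unfolding L_def by blast
    with is_oracle_yes_le[OF R, of a b c d] that(2,3) show ?thesis
      by (simp add: of_rat_less_eq)
  qed
  have "L \<noteq> {}" using ab0 unfolding L_def by blast
  have "bdd_above L" using upper[OF _ ab0] by (rule bdd_aboveI)
  define x where "x = Sup L"
  have enc: "of_rat a \<le> x \<and> x \<le> of_rat b" if "a \<le> b" "R (ivl a b)" for a b
    unfolding x_def
  proof
    show "of_rat a \<le> Sup L"
      using that \<open>bdd_above L\<close> by (intro cSup_upper) (auto simp: L_def)
    show "Sup L \<le> of_rat b"
      using \<open>L \<noteq> {}\<close> upper that by (intro cSup_least)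
  qed
  \<comment> \<open>Closedness enters here: if \<open>x\<close> is a rational \<open>q\<close>, then
    \<open>q\<close> lies in all Yes intervals by \<open>enc\<close>.\<close>
  have root: "R (ivl q q)" if "x = of_rat q" for q
  proof -
    have "q \<in> points (ivl a b)" if "R (ivl a b)" for a b
      using enc[of "min a b" "max a b"] that \<open>x = of_rat q\<close>
      by (auto simp: points_ivl of_rat_less_eq min_def max_def ivl_commute split: if_splits)
    then show ?thesis
      using R unfolding is_oracle_def closed_rule_def by blast
  qed
  have "R I = encloses x I" for I
  proof (cases I rule: rat_interval_cases)
    case (1 a b)
    have "R (ivl a b)" if ab: "of_rat a \<le> x" "x \<le> of_rat b"
    proof (cases "of_rat a = x \<or> x = of_rat b")
      case True
      then show ?thesis
        using root[of a] root[of b] is_oracle_mono[OF R] \<open>a \<le> b\<close> by (metis order_refl)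
    next
      case False
      \<comment> \<open>Now \<open>x\<close> is strictly inside. A Yes interval shorter than the
        distance from \<open>x\<close> to either endpoint contains \<open>x\<close>, hence stays
        between \<open>a\<close> and \<open>b\<close>, and consistency enlarges it to the whole
        interval.\<close>
      then have "0 < min (x - of_rat a) (of_rat b - x)" using ab by auto
      then obtain e where e: "0 < real_of_rat e" "of_rat e < min (x - of_rat a) (of_rat b - x)"
        using of_rat_dense by blast
      then obtain c d where cd: "c \<le> d" "R (ivl c d)" "d - c < e"
        using is_oracle_short[OF R, of e] by auto
      have "real_of_rat d - real_of_rat c < real_of_rat e"
        using cd(3) by (simp flip: of_rat_diff add: of_rat_less)
      with enc[OF cd(1,2)] e have "real_of_rat a \<le> of_rat c" "real_of_rat d \<le> of_rat b"
        by auto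
      then show ?thesis
        using is_oracle_mono[OF R cd(2) _ cd(1)] by (simp add: of_rat_less_eq)
    qed
    with enc 1 show ?thesis by (auto simp: encloses_ivl)
  qed
  then show thesis using that by blast
qed

section \<open>The order-preserving bijection between oracles and reals\<close>

definition oracle_of_real :: "real \<Rightarrow> rat_oracle"
  where "oracle_of_real x = Oracle (encloses x)"

definition real_of_oracle :: "rat_oracle \<Rightarrow> real"
  where "real_of_oracle \<alpha> = (THE x. yes \<alpha> = encloses x)"

lemma yes_oracle_of_real: "yes (oracle_of_real x) = encloses x"
  by (simp add: oracle_of_real_def Oracle_inverse is_oracle_encloses)

lemma real_of_oracle_of_real [simp]: "real_of_oracle (oracle_of_real x) = x"
  by (simp add: real_of_oracle_def yes_oracle_of_real encloses_inject)

text \<open>Shows that the definite description in \<open>real_of_oracle\<close> is well defined: a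
  real exists by \<open>is_oracle_imp_encloses\<close> and is unique by
  \<open>encloses_inject\<close>.\<close>

lemma yes_eq_encloses: "yes \<alpha> = encloses (real_of_oracle \<alpha>)"
proof -
  obtain x where "yes \<alpha> = encloses x"
    using is_oracle_imp_encloses yes[of \<alpha>] by blast
  then show ?thesis
    by (simp add: real_of_oracle_def encloses_inject)
qed

text \<open>Turns equations between oracles into equations between reals. Together with its
  analogues for order, sum and product it carries the final transport.\<close>

lemma real_of_oracle_inject: "\<alpha> = \<beta> \<longleftrightarrow> real_of_oracle \<alpha> = real_of_oracle \<beta>"
  by (metis yes_eq_encloses yes_inject)

lemma real_of_oracle_less: "\<alpha> < \<beta> \<longleftrightarrow> real_of_oracle \<alpha> < real_of_oracle \<beta>"
proof
  assume "\<alpha> < \<beta>"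
  then obtain a b c d where "encloses (real_of_oracle \<alpha>) (ivl a b)"
    "encloses (real_of_oracle \<beta>) (ivl c d)" and "max a b < min c d"
    unfolding less_rat_oracle_def yes_eq_encloses by auto
  moreover from this(3) have "real_of_rat (max a b) < of_rat (min c d)"
    by (simp only: of_rat_less)
  ultimately show "real_of_oracle \<alpha> < real_of_oracle \<beta>"
    unfolding encloses_ivl_min_max by linarith
next
  assume less: "real_of_oracle \<alpha> < real_of_oracle \<beta>"
  \<comment> \<open>Two rationals \<open>b < c\<close> are taken in the gap between the reals,
    \<open>b\<close> to end the interval of the smaller and \<open>c\<close> to begin that of the
    larger; \<open>a\<close> and \<open>d\<close> merely close the intervals on the outside.\<close>
  then obtain c where c: "real_of_oracle \<alpha> < of_rat c" "of_rat c < real_of_oracle \<beta>"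
    using of_rat_dense by blast
  then obtain b where b: "real_of_oracle \<alpha> < of_rat b" "real_of_rat b < of_rat c"
    using of_rat_dense by blast
  obtain a where a: "of_rat a < real_of_oracle \<alpha>" using of_rat_dense lt_ex by meson
  obtain d where d: "real_of_oracle \<beta> < of_rat d" using of_rat_dense gt_ex by meson
  have "a < b" "b < c" "c < d"
    using a b c d by (metis less_trans of_rat_less)+
  then have "yes \<alpha> (ivl a b)" "yes \<beta> (ivl c d)" "a < c" "a < d" "b < c" "b < d"
    using a b c d by (auto simp: yes_eq_encloses encloses_ivl)
  then show "\<alpha> < \<beta>" unfolding less_rat_oracle_def by blast
qed

lemma real_of_oracle_le: "\<alpha> \<le> \<beta> \<longleftrightarrow> real_of_oracle \<alpha> \<le> real_of_oracle \<beta>"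
  unfolding less_eq_rat_oracle_def real_of_oracle_less real_of_oracle_inject by linarith

section \<open>Sums and products of oracles\<close>

lemma rat_approximation:
  fixes x :: real
  shows "\<exists>a b :: nat \<Rightarrow> rat. (\<forall>n. of_rat (a n) \<le> x \<and> x \<le> of_rat (b n) \<and> a n \<le> b n) \<and>
    (\<lambda>n. of_rat (a n)) \<longlonglongrightarrow> x \<and> (\<lambda>n. of_rat (b n)) \<longlonglongrightarrow> x"
proof -
  have "\<forall>n. \<exists>q. x - inverse (of_nat (Suc n)) < of_rat q \<and> of_rat q < x"
    by (intro allI of_rat_dense) simp
  then obtain a where a: "\<And>n. x - inverse (of_nat (Suc n)) < of_rat (a n)" "\<And>n. of_rat (a n) < x"
    by metis
  have "\<forall>n. \<exists>q. x < of_rat q \<and> of_rat q < x + inverse (of_nat (Suc n))"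
    by (intro allI of_rat_dense) simp
  then obtain b where b: "\<And>n. x < of_rat (b n)" "\<And>n. of_rat (b n) < x + inverse (of_nat (Suc n))"
    by metis
  show ?thesis
  proof (intro exI conjI allI)
    show "of_rat (a n) \<le> x" "x \<le> of_rat (b n)" for n
      using a(2) b(1) less_imp_le by blast+
    then show "a n \<le> b n" for n
      by (metis of_rat_less_eq order_trans)
    show "(\<lambda>n. of_rat (a n)) \<longlonglongrightarrow> x"
      by (rule tendsto_sandwich[OF _ _ LIMSEQ_inverse_real_of_nat_add_minus[of x] tendsto_const])
        (use a in \<open>auto intro!: always_eventually less_imp_le\<close>)
    show "(\<lambda>n. of_rat (b n)) \<longlonglongrightarrow> x"
      by (rule tendsto_sandwich[OF _ _ tendsto_const LIMSEQ_inverse_real_of_nat_add[of x]])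
        (use b in \<open>auto intro!: always_eventually less_imp_le\<close>)
  qed
qed

text \<open>Evaluates the \<open>THE\<close> in \<open>associated_oracle\<close>. The oracle of
  \<open>x\<close> is a candidate since all members of \<open>F\<close> enclose \<open>x\<close>. It
  is the only one, because the real of any candidate is caught between the endpoints of every
  \<open>I n\<close>, and both converge to \<open>x\<close>. In the applications the
  \<open>I n\<close> come from \<open>rat_approximation\<close>.\<close>

lemma real_of_associated_oracle:
  assumes enc: "\<And>I. I \<in> F \<Longrightarrow> encloses x I"
    and I: "\<And>n. I n \<in> F" "(\<lambda>n. of_rat (lo (I n))) \<longlonglongrightarrow> x" "(\<lambda>n. of_rat (hi (I n))) \<longlonglongrightarrow> x"
  shows "real_of_oracle (associated_oracle F) = x"
proof -
  have "associated_oracle F = oracle_of_real x"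
    unfolding associated_oracle_def
  proof (rule the_equality)
    show "\<forall>I\<in>F. yes (oracle_of_real x) I"
      using enc by (simp add: yes_oracle_of_real)
  next
    fix \<alpha> assume "\<forall>I\<in>F. yes \<alpha> I"
    then have bounds: "of_rat (lo (I n)) \<le> real_of_oracle \<alpha>" "real_of_oracle \<alpha> \<le> of_rat (hi (I n))" for n
      using I(1) by (auto simp: yes_eq_encloses encloses_def)
    have "x \<le> real_of_oracle \<alpha>" "real_of_oracle \<alpha> \<le> x"
      using LIMSEQ_le_const2[OF I(2)] LIMSEQ_le_const[OF I(3)] bounds by blast+
    then show "\<alpha> = oracle_of_real x"
      by (simp add: real_of_oracle_inject)
  qed
  then show ?thesis by simp
qed

lemma real_of_oracle_add: "real_of_oracle (\<alpha> + \<beta>) = real_of_oracle \<alpha> + real_of_oracle \<beta>"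
proof -
  let ?x = "real_of_oracle \<alpha>" and ?y = "real_of_oracle \<beta>"
  obtain a b where ab: "\<And>n. of_rat (a n) \<le> ?x" "\<And>n. ?x \<le> of_rat (b n)" "\<And>n. a n \<le> b n"
    "(\<lambda>n. of_rat (a n)) \<longlonglongrightarrow> ?x" "(\<lambda>n. of_rat (b n)) \<longlonglongrightarrow> ?x"
    using rat_approximation[of ?x] by blast
  obtain c d where cd: "\<And>n. of_rat (c n) \<le> ?y" "\<And>n. ?y \<le> of_rat (d n)" "\<And>n. c n \<le> d n"
    "(\<lambda>n. of_rat (c n)) \<longlonglongrightarrow> ?y" "(\<lambda>n. of_rat (d n)) \<longlonglongrightarrow> ?y"
    using rat_approximation[of ?y] by blast
  show ?thesis
    unfolding plus_rat_oracle_def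
  proof (rule real_of_associated_oracle)
    fix I assume "I \<in> {A \<oplus> B | A B. yes \<alpha> A \<and> yes \<beta> B}"
    then obtain A B where I: "I = A \<oplus> B" and AB: "encloses ?x A" "encloses ?y B"
      by (auto simp: yes_eq_encloses)
    obtain p q where A: "A = ivl p q" "p \<le> q" by (rule rat_interval_cases)
    obtain r s where B: "B = ivl r s" "r \<le> s" by (rule rat_interval_cases)
    show "encloses (?x + ?y) I"
      using I AB A B by (simp add: iadd_ivl encloses_ivl of_rat_add)
  next
    have "yes \<alpha> (ivl (a n) (b n))" "yes \<beta> (ivl (c n) (d n))" for n
      using ab(1-3)[of n] cd(1-3)[of n] by (simp_all add: yes_eq_encloses encloses_ivl)
    then show "ivl (a n) (b n) \<oplus> ivl (c n) (d n) \<in> {A \<oplus> B | A B. yes \<alpha> A \<and> yes \<beta> B}" for n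
      by blast
    show "(\<lambda>n. of_rat (lo (ivl (a n) (b n) \<oplus> ivl (c n) (d n)))) \<longlonglongrightarrow> ?x + ?y"
      "(\<lambda>n. of_rat (hi (ivl (a n) (b n) \<oplus> ivl (c n) (d n)))) \<longlonglongrightarrow> ?x + ?y"
      using ab cd
      by (simp_all add: iadd_ivl lo_ivl hi_ivl add_mono of_rat_add tendsto_add)
  qed
qed

lemma of_rat_min: "real_of_rat (min a b) = min (of_rat a) (of_rat b)"
  by (simp add: min_def of_rat_less_eq)

lemma of_rat_max: "real_of_rat (max a b) = max (of_rat a) (of_rat b)"
  by (simp add: max_def of_rat_less_eq)

text \<open>For fixed \<open>y\<close> the product is monotone or antitone in the first factor, so
  \<open>x * y\<close> lies between \<open>a * y\<close> and \<open>b * y\<close>. Each of these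
  lies between two corners by the same argument in the second factor.\<close>

lemma mult_between_corners:
  fixes x y :: "'a :: linordered_idom"
  assumes "a \<le> x" "x \<le> b" "c \<le> y" "y \<le> d"
  shows "min (min (a * c) (a * d)) (min (b * c) (b * d)) \<le> x * y"
    and "x * y \<le> max (max (a * c) (a * d)) (max (b * c) (b * d))"
proof -
  have "(a * y \<le> x * y \<and> x * y \<le> b * y) \<or> (b * y \<le> x * y \<and> x * y \<le> a * y)"
    using assms by (metis linear mult_right_mono mult_right_mono_neg)
  moreover have "(z * c \<le> z * y \<and> z * y \<le> z * d) \<or> (z * d \<le> z * y \<and> z * y \<le> z * c)" for z
    using assms by (metis linear mult_left_mono mult_left_mono_neg)
  ultimately show "min (min (a * c) (a * d)) (min (b * c) (b * d)) \<le> x * y"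
    "x * y \<le> max (max (a * c) (a * d)) (max (b * c) (b * d))"
    unfolding min_le_iff_disj le_max_iff_disj by (meson order_trans)+
qed

text \<open>Nested binary minima and maxima of real corner products, in place of \<open>Min\<close>
  and \<open>Max\<close> of a set of rationals, fit both \<open>mult_between_corners\<close> and the
  limit rules \<open>tendsto_min\<close> and \<open>tendsto_max\<close>.\<close>

lemma
  assumes "a \<le> b" "c \<le> d"
  shows lo_imult_ivl: "real_of_rat (lo (ivl a b \<otimes> ivl c d)) =
      min (min (of_rat a * of_rat c) (of_rat a * of_rat d))
        (min (of_rat b * of_rat c) (of_rat b * of_rat d))"
    and hi_imult_ivl: "real_of_rat (hi (ivl a b \<otimes> ivl c d)) =
      max (max (of_rat a * of_rat c) (of_rat a * of_rat d))
        (max (of_rat b * of_rat c) (of_rat b * of_rat d))"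
proof -
  let ?P = "{a * c, a * d, b * c, b * d}"
  \<comment> \<open>Since \<open>ivl\<close> sorts its arguments, this inequality is what identifies
    \<open>lo\<close> with \<open>Min ?P\<close> and \<open>hi\<close> with
    \<open>Max ?P\<close>.\<close>
  have "Min ?P \<le> Max ?P" by (meson Max_ge Min_in finite.intros insert_not_empty)
  then have "lo (ivl a b \<otimes> ivl c d) = Min ?P" "hi (ivl a b \<otimes> ivl c d) = Max ?P"
    using assms by (simp_all only: imult_ivl lo_ivl hi_ivl min_def max_def if_True)
  then show "real_of_rat (lo (ivl a b \<otimes> ivl c d)) =
      min (min (of_rat a * of_rat c) (of_rat a * of_rat d))
        (min (of_rat b * of_rat c) (of_rat b * of_rat d))"
    "real_of_rat (hi (ivl a b \<otimes> ivl c d)) =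
      max (max (of_rat a * of_rat c) (of_rat a * of_rat d))
        (max (of_rat b * of_rat c) (of_rat b * of_rat d))"
    by (simp_all add: of_rat_min of_rat_max of_rat_mult min.assoc max.assoc)
qed

lemma real_of_oracle_mult: "real_of_oracle (\<alpha> * \<beta>) = real_of_oracle \<alpha> * real_of_oracle \<beta>"
proof -
  let ?x = "real_of_oracle \<alpha>" and ?y = "real_of_oracle \<beta>"
  obtain a b where ab: "\<And>n. of_rat (a n) \<le> ?x" "\<And>n. ?x \<le> of_rat (b n)" "\<And>n. a n \<le> b n"
    "(\<lambda>n. of_rat (a n)) \<longlonglongrightarrow> ?x" "(\<lambda>n. of_rat (b n)) \<longlonglongrightarrow> ?x"
    using rat_approximation[of ?x] by blast
  obtain c d where cd: "\<And>n. of_rat (c n) \<le> ?y" "\<And>n. ?y \<le> of_rat (d n)" "\<And>n. c n \<le> d n"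
    "(\<lambda>n. of_rat (c n)) \<longlonglongrightarrow> ?y" "(\<lambda>n. of_rat (d n)) \<longlonglongrightarrow> ?y"
    using rat_approximation[of ?y] by blast
  show ?thesis
    unfolding times_rat_oracle_def
  proof (rule real_of_associated_oracle)
    fix I assume "I \<in> {A \<otimes> B | A B. yes \<alpha> A \<and> yes \<beta> B}"
    then obtain A B where I: "I = A \<otimes> B" and AB: "encloses ?x A" "encloses ?y B"
      by (auto simp: yes_eq_encloses)
    obtain p q where A: "A = ivl p q" "p \<le> q" by (rule rat_interval_cases)
    obtain r s where B: "B = ivl r s" "r \<le> s" by (rule rat_interval_cases)
    have "of_rat p \<le> ?x" "?x \<le> of_rat q" "of_rat r \<le> ?y" "?y \<le> of_rat s"
      using AB A B by (simp_all add: encloses_ivl)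
    then show "encloses (?x * ?y) I"
      unfolding I A(1) B(1) encloses_def lo_imult_ivl[OF A(2) B(2)] hi_imult_ivl[OF A(2) B(2)]
      by (intro conjI mult_between_corners)
  next
    have "yes \<alpha> (ivl (a n) (b n))" "yes \<beta> (ivl (c n) (d n))" for n
      using ab(1-3)[of n] cd(1-3)[of n] by (simp_all add: yes_eq_encloses encloses_ivl)
    then show "ivl (a n) (b n) \<otimes> ivl (c n) (d n) \<in> {A \<otimes> B | A B. yes \<alpha> A \<and> yes \<beta> B}" for n
      by blast
    \<comment> \<open>All four corner products tend to \<open>?x * ?y\<close>, hence so do their
      minimum and maximum.\<close>
    note lims = tendsto_mult[OF ab(4) cd(4)] tendsto_mult[OF ab(4) cd(5)]
      tendsto_mult[OF ab(5) cd(4)] tendsto_mult[OF ab(5) cd(5)]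
    show "(\<lambda>n. of_rat (lo (ivl (a n) (b n) \<otimes> ivl (c n) (d n)))) \<longlonglongrightarrow> ?x * ?y"
      unfolding lo_imult_ivl[OF ab(3) cd(3)]
      using tendsto_min[OF tendsto_min[OF lims(1,2)] tendsto_min[OF lims(3,4)]] by simp
    show "(\<lambda>n. of_rat (hi (ivl (a n) (b n) \<otimes> ivl (c n) (d n)))) \<longlonglongrightarrow> ?x * ?y"
      unfolding hi_imult_ivl[OF ab(3) cd(3)]
      using tendsto_max[OF tendsto_max[OF lims(1,2)] tendsto_max[OF lims(3,4)]] by simp
  qed
qed

section \<open>Field structure and least upper bounds\<close>

instantiation rat_oracle :: linordered_field
begin

text \<open>Sum, product and order remain those coming from intervals; only the other operations are
  pulled back from the reals. Every class axiom then becomes its real counterpart under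
  \<open>real_of_oracle\<close>.\<close>

definition "0 = oracle_of_real 0"
definition "1 = oracle_of_real 1"
definition "- \<alpha> = oracle_of_real (- real_of_oracle \<alpha>)"
definition "\<alpha> - \<beta> = oracle_of_real (real_of_oracle \<alpha> - real_of_oracle \<beta>)"
definition "inverse \<alpha> = oracle_of_real (inverse (real_of_oracle \<alpha>))"
definition "\<alpha> div \<beta> = oracle_of_real (real_of_oracle \<alpha> / real_of_oracle \<beta>)"
definition "\<bar>\<alpha>\<bar> = oracle_of_real \<bar>real_of_oracle \<alpha>\<bar>"
definition "sgn \<alpha> = oracle_of_real (sgn (real_of_oracle \<alpha>))"

instance
  by standard
    (auto simp: real_of_oracle_inject real_of_oracle_less real_of_oracle_le
      real_of_oracle_add real_of_oracle_mult zero_rat_oracle_def one_rat_oracle_def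
      uminus_rat_oracle_def minus_rat_oracle_def inverse_rat_oracle_def divide_rat_oracle_def
      abs_rat_oracle_def sgn_rat_oracle_def divide_inverse algebra_simps sgn_if
      mult_strict_left_mono)

end

text \<open>The bound \<open>u\<close> also bounds the real image of \<open>S\<close>, so its
  supremum exists. By \<open>real_of_oracle_le\<close> the order transfers in both directions, and
  the least upper bound with it.\<close>

lemma rat_oracle_complete:
  fixes S :: "rat_oracle set"
  assumes "S \<noteq> {}" "isUb UNIV S u"
  shows "isLub UNIV S (oracle_of_real (SUP \<alpha>\<in>S. real_of_oracle \<alpha>))"
proof -
  have "bdd_above (real_of_oracle ` S)"
    using assms(2) by (auto simp: isUb_def setle_def real_of_oracle_le intro!: bdd_aboveI2)
  then show ?thesis
    using \<open>S \<noteq> {}\<close>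
    by (auto simp: isLub_def leastP_def isUb_def setle_def setge_def real_of_oracle_le
        intro: cSUP_upper cSUP_least)
qed

theorem theorem5p10:
  shows "(\<exists>divd inv one zero mns umns sg ab.
            class.linordered_field divd inv (*) one (+) zero mns umns
              (\<le>) ((<) :: rat_oracle \<Rightarrow> rat_oracle \<Rightarrow> bool) sg ab)
       \<and> (\<forall>S :: rat_oracle set. S \<noteq> {} \<and> (\<exists>u. isUb UNIV S u) \<longrightarrow> (\<exists>s. isLub UNIV S s))"
  \<comment> \<open>The operations of the class instance witness the existential
    quantifiers.\<close>
  using linordered_field_class.linordered_field_axioms rat_oracle_complete by blast

end
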